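(* Let $k\in\{2,3,4\}$, let $\Delta t>0$ and $N_t\in\mathbb{N}$, $N_t\ge k$, be arbitrary, and let $M>0$ and $0<\varepsilon\le1$. Let $\phi^0=\phi_0,\phi^1,\dots,\phi^{k-1}$ be given starting functions on $\Omega$, $R^0=\exp(E(\phi^0))$, and let $R^1,\dots,R^{k-1}>0$ be given starting values. Suppose that $(\phi^{n})_{0\le n\le N_t}$, $(\mu^{n})_{k\le n\le N_t}$ (real-valued functions on $\Omega$) and $(R^n)_{0\le n\le N_t}$, $(\xi^n)_{k\le n\le N_t}$ (real numbers) satisfy the $k$-th order BDF$k$ ESI-SAV scheme for the nonlocal Cahn-Hilliard equation: for all $k-1\le n\le N_t-1$, $$D_k\phi^{n+1}=-M\mathcal{L}\mu^{n+1},$$ $$\mu^{n+1}=\varepsilon^2\mathcal{L}\phi^{n+1}+V_k(\xi^{n+1})f(\phi^{*,n+1}),$$ $$\xi^{n+1}=\frac{R^{n+1}}{\exp\left(E(\phi^{*,n+1})\right)},$$ $$\frac{R^{n+1}-R^n}{\Delta t}=R^{n+1}\left(-M\mathcal{L}\bar\mu^{n+1},\bar\mu^{n+1}\right),$$ where $\bar\mu^{n+1}=\varepsilon^2\mathcal{L}\phi^{*,n+1}+f(\phi^{*,n+1})$, $\phi^{*,n+1}$ is any explicit $O(\Delta t^k)$ approximation of $\phi(t^{n+1})$, and $$D_2\phi^{n+1}=\frac{3\phi^{n+1}-4\phi^n+\phi^{n-1}}{2\Delta t},\qquad V_2(\xi)=\xi(2-\xi),$$ $$D_3\phi^{n+1}=\frac{11\phi^{n+1}-18\phi^n+9\phi^{n-1}-2\phi^{n-2}}{6\Delta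 t},\qquad V_3(\xi)=\xi(3-3\xi+\xi^2),$$ $$D_4\phi^{n+1}=\frac{25\phi^{n+1}-48\phi^n+36\phi^{n-1}-16\phi^{n-2}+3\phi^{n-3}}{12\Delta t},\qquad V_4(\xi)=\xi(2-\xi)(2-2\xi+\xi^2).$$ Then, for each $k\in\{2,3,4\}$, the scheme is unconditionally energy stable, in the sense that, with no restriction on $\Delta t$, for all $k-1\le n\le N_t-1$, $$R^{n+1}-R^n=R^{n+1}\Delta t\left(-M\mathcal{L}\bar\mu^{n+1},\bar\mu^{n+1}\right)\le 0,$$ and moreover $$\ln R^{n+1}-\ln R^n\le 0.$$
   Context: $\Omega\subset\mathbb{R}^d$ ($d=1,2,3$) is a bounded rectangular cell. $(\phi,\varphi)=\int_\Omega\phi(\mathbf{x})\varphi(\mathbf{x})\,d\mathbf{x}$ is the $L^2(\Omega)$ inner product. All functions are real-valued. The interaction kernel $J$ is integrable on $\Omega$ and satisfies: (a) $J(\mathbf{x})\ge 0$ for all $\mathbf{x}\in\Omega$; (b) $J(\mathbf{x})=J(-\mathbf{x})$; (c) $J$ is $\Omega$-periodic (periodic in each coordinate with period the corresponding side length of $\Omega$); (d) $J$ is radial, meaning that on the period cell centred at the origin $J(\mathbf{x})$ depends only on $|\mathbf{x}|$. The nonlocal diffusion operator is $$\mathcal{L}\phi(\mathbf{x})=\int_\Omega J(\mathbf{x}-\mathbf{y})\left(\phi(\mathbf{x})-\phi(\mathbf{y})\right)d\mathbf{y},\quad \mathbf{x}\in\Omega.$$ $F:\mathbb{R}\to\mathbb{R}$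 is a general nonlinear $C^1$ potential (typical example: $F(\phi)=\frac14(\phi^2-1)^2$) and $f=F'$. The free energy is $$E(\phi)=\frac{\varepsilon^2}{2}(\mathcal{L}\phi,\phi)+\int_\Omega F(\phi)\,d\mathbf{x}.$$ The nonlocal Cahn-Hilliard equation is $\partial_t\phi=-M\mathcal{L}\mu$, $\mu=\varepsilon^2\mathcal{L}\phi+f(\phi)$, with mobility constant $M>0$; $\phi(t)$ denotes its exact solution and $t^{n}=n\Delta t$. In the scheme, $R^n$ approximates the exponential scalar auxiliary variable $R(t)=\exp(E(\phi(t)))>0$. "Explicit $O(\Delta t^k)$ approximation" means: $\phi^{*,n+1}$ is a function on $\Omega$ computed from $\phi^0,\dots,\phi^n$ whose error relative to $\phi(t^{n+1})$ is of order $\Delta t^k$ as $\Delta t\to0$ (an asymptotic consistency requirement, imposing no condition for one fixed $\Delta t$). Examples: $\phi^{*,n+1}=2\phi^n-\phi^{n-1}$ for $k=2$; $\phi^{*,n+1}=3\phi^n-3\phi^{n-1}+\phi^{n-2}$ for $k=3$; $\phi^{*,n+1}=4\phi^n-6\phi^{n-1}+4\phi^{n-2}-\phi^{n-3}$ for $k=4$. Functions are $\Omega$-periodic and assumed regular enough that all expressions are well defined; in particular $\phi^n$, $\phi^{*,n+1}$, $f(\phi^{*,n+1})$, $\mu^{n+1}$, $\bar\mu^{n+1}$ belong to $L^2(\Omega)$ and $E(\phi^0)$, $E(\phi^{*,n+1})$ are finite. *)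

theory Defs
  imports "HOL-Analysis.Analysis"
begin

definition cell_periodic :: "real^'d \<Rightarrow> real^'d \<Rightarrow> (real^'d \<Rightarrow> real) \<Rightarrow> bool" where
  "cell_periodic a b u \<longleftrightarrow> (\<forall>x i. u (x + axis i (b $ i - a $ i)) = u x)"

definition L2_fun :: "(real^'d) set \<Rightarrow> (real^'d \<Rightarrow> real) \<Rightarrow> bool" where
  "L2_fun \<Omega> u \<longleftrightarrow>
     u \<in> borel_measurable (lebesgue_on \<Omega>) \<and> integrable (lebesgue_on \<Omega>) (\<lambda>x. (u x)\<^sup>2)"

definition L2_inner :: "(real^'d) set \<Rightarrow> (real^'d \<Rightarrow> real) \<Rightarrow> (real^'d \<Rightarrow> real) \<Rightarrow> real" where
  "L2_inner \<Omega> u v = (LINT x|lebesgue_on \<Omega>. u x * v x)"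

text \<open>
  The last conjunct is radial symmetry, required only on the period cell centred at the origin:
  a nonconstant periodic function cannot in general be radial on the whole space.
\<close>

definition interaction_kernel :: "real^'d \<Rightarrow> real^'d \<Rightarrow> (real^'d \<Rightarrow> real) \<Rightarrow> bool" where
  "interaction_kernel a b J \<longleftrightarrow>
     integrable (lebesgue_on (cbox a b)) J \<and>
     (\<forall>x\<in>cbox a b. 0 \<le> J x) \<and>
     (\<forall>x. J x = J (- x)) \<and>
     cell_periodic a b J \<and>
     (\<exists>j. \<forall>x. (\<forall>i. \<bar>x $ i\<bar> \<le> (b $ i - a $ i) / 2) \<longrightarrow> J x = j (norm x))"

definition nonlocal_op ::
  "(real^'d) set \<Rightarrow> (real^'d \<Rightarrow> real) \<Rightarrow> (real^'d \<Rightarrow> real) \<Rightarrow> real^'d \<Rightarrow> real" where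
  "nonlocal_op \<Omega> J u x = (LINT y|lebesgue_on \<Omega>. J (x - y) * (u x - u y))"

definition free_energy ::
  "(real^'d) set \<Rightarrow> (real^'d \<Rightarrow> real) \<Rightarrow> real \<Rightarrow> (real \<Rightarrow> real) \<Rightarrow> (real^'d \<Rightarrow> real) \<Rightarrow> real" where
  "free_energy \<Omega> J \<epsilon> F u =
     \<epsilon>\<^sup>2 / 2 * L2_inner \<Omega> (nonlocal_op \<Omega> J u) u + (LINT x|lebesgue_on \<Omega>. F (u x))"

definition chem_potential ::
  "(real^'d) set \<Rightarrow> (real^'d \<Rightarrow> real) \<Rightarrow> real \<Rightarrow> (real \<Rightarrow> real) \<Rightarrow> (real^'d \<Rightarrow> real) \<Rightarrow> real^'d \<Rightarrow> real" where
  "chem_potential \<Omega> J \<epsilon> f u x = \<epsilon>\<^sup>2 * nonlocal_op \<Omega> J u x + f (u x)"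

text \<open>
  \<open>bdf k \<tau> \<phi> n\<close> is the BDF quotient \<open>D\<^sub>k \<phi>\<^bsup>n+1\<^esup>\<close> with step \<open>\<tau>\<close>: the index \<open>n\<close> is that of the
  last known level, so the truncated subtractions below are harmless for \<open>k - 1 \<le> n\<close>.
\<close>

definition bdf :: "nat \<Rightarrow> real \<Rightarrow> (nat \<Rightarrow> real^'d \<Rightarrow> real) \<Rightarrow> nat \<Rightarrow> real^'d \<Rightarrow> real" where
  "bdf k \<tau> \<phi> n x =
     (if k = 2 then (3 * \<phi> (n+1) x - 4 * \<phi> n x + \<phi> (n-1) x) / (2 * \<tau>)
      else if k = 3 then
        (11 * \<phi> (n+1) x - 18 * \<phi> n x + 9 * \<phi> (n-1) x - 2 * \<phi> (n-2) x) / (6 * \<tau>)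
      else if k = 4 then
        (25 * \<phi> (n+1) x - 48 * \<phi> n x + 36 * \<phi> (n-1) x - 16 * \<phi> (n-2) x + 3 * \<phi> (n-3) x)
          / (12 * \<tau>)
      else undefined)"

definition V :: "nat \<Rightarrow> real \<Rightarrow> real" where
  "V k \<xi> =
     (if k = 2 then \<xi> * (2 - \<xi>)
      else if k = 3 then \<xi> * (3 - 3 * \<xi> + \<xi>\<^sup>2)
      else if k = 4 then \<xi> * (2 - \<xi>) * (2 - 2 * \<xi> + \<xi>\<^sup>2)
      else undefined)"

text \<open>
  \<open>extrap n [\<phi>\<^sup>0, \<dots>, \<phi>\<^sup>n]\<close> is the explicit approximation \<open>\<phi>s (n+1)\<close> of the solution at the next
  time level. Its order of accuracy is a condition on the limit \<open>\<tau> \<rightarrow> 0\<close> and hence no condition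
  at the single fixed step \<open>\<tau>\<close> considered here. The two equations between functions
  are equations in \<open>L\<^sup>2(\<Omega>)\<close>, that is, almost everywhere.
\<close>

definition esi_sav_scheme ::
  "nat \<Rightarrow> nat \<Rightarrow> real \<Rightarrow> real \<Rightarrow> real \<Rightarrow> (real^'d) set \<Rightarrow> (real^'d \<Rightarrow> real) \<Rightarrow>
   (real \<Rightarrow> real) \<Rightarrow> (real \<Rightarrow> real) \<Rightarrow>
   (nat \<Rightarrow> (real^'d \<Rightarrow> real) list \<Rightarrow> real^'d \<Rightarrow> real) \<Rightarrow>
   (nat \<Rightarrow> real^'d \<Rightarrow> real) \<Rightarrow> (nat \<Rightarrow> real^'d \<Rightarrow> real) \<Rightarrow> (nat \<Rightarrow> real^'d \<Rightarrow> real) \<Rightarrow>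
   (nat \<Rightarrow> real) \<Rightarrow> (nat \<Rightarrow> real) \<Rightarrow> bool" where
  "esi_sav_scheme k N \<tau> M \<epsilon> \<Omega> J F f extrap \<phi> \<phi>s \<mu> R \<xi> \<longleftrightarrow>
     (\<forall>n\<in>{k-1..N-1}.
        \<phi>s (n+1) = extrap n (map \<phi> [0..<n+1]) \<and>
        (AE x in lebesgue_on \<Omega>. bdf k \<tau> \<phi> n x = - M * nonlocal_op \<Omega> J (\<mu> (n+1)) x) \<and>
        (AE x in lebesgue_on \<Omega>.
           \<mu> (n+1) x = \<epsilon>\<^sup>2 * nonlocal_op \<Omega> J (\<phi> (n+1)) x + V k (\<xi> (n+1)) * f (\<phi>s (n+1) x)) \<and>
        \<xi> (n+1) = R (n+1) / exp (free_energy \<Omega> J \<epsilon> F (\<phi>s (n+1))) \<and>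
        (R (n+1) - R n) / \<tau> =
          R (n+1) * L2_inner \<Omega> (\<lambda>x. - M * nonlocal_op \<Omega> J (chem_potential \<Omega> J \<epsilon> f (\<phi>s (n+1))) x)
                               (chem_potential \<Omega> J \<epsilon> f (\<phi>s (n+1))))"

end

theory Submission
  imports Defs
begin

text \<open>
  The last equation of the scheme is linear in \<open>R\<^bsup>n+1\<^esup>\<close>: with
  \<open>d = - M * \<tau> * (\<L> \<mu>bar, \<mu>bar)\<close> it reads \<open>(1 - d) * R\<^bsup>n+1\<^esup> = R\<^bsup>n\<^esup>\<close>. If \<open>d \<le> 0\<close>, then positivity of
  \<open>R\<close> passes from one step to the next (\<open>implicit_step_pos\<close>), hence
  \<open>R\<^bsup>n+1\<^esup> - R\<^bsup>n\<^esup> = R\<^bsup>n+1\<^esup> * d \<le> 0\<close>, and the logarithm is monotone. The same equation determines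
  \<open>R\<close> for all three orders, which are therefore treated alike.

  What remains is \<open>(\<L> u, u) \<ge> 0\<close> for square integrable \<open>u\<close> (\<open>nonlocal_op_nonneg\<close>). Formally,
  since \<open>J (x - y) = J (y - x)\<close>, exchanging the two variables shows that \<open>(\<L> u, u)\<close> is half the
  double integral of \<open>J (x - y) * (u x - u y)\<^sup>2\<close> (\<open>symmetric_kernel_form_nonneg\<close>). The work lies
  in justifying Fubini for a kernel that is merely integrable on one cell: by periodicity it is
  nonnegative everywhere and integrable on all differences of points of the cell
  (\<open>cell_periodic_set_integrable_cbox\<close>), and a Borel representative of it makes the integrand
  measurable on the product space (\<open>even_kernel_borel_representative\<close>).
\<close>


section \<open>Energy of a symmetric kernel\<close>

text \<open>
  Symmetrising: exchanging \<open>x\<close> and \<open>y\<close> in the double integral and averaging with the original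
  gives half the integral of \<open>K x y * (v x - v y)\<^sup>2\<close>. The hypothesis \<open>int\<close> makes Fubini applicable,
  as the mixed term \<open>K x y * v x * v y\<close> is dominated by the two square terms, which are
  exchanged by the symmetry of \<open>K\<close>.
\<close>

lemma (in sigma_finite_measure) symmetric_kernel_form_nonneg:
  fixes K :: "'a \<Rightarrow> 'a \<Rightarrow> real" and v :: "'a \<Rightarrow> real"
  assumes K [measurable]: "case_prod K \<in> borel_measurable (M \<Otimes>\<^sub>M M)"
    and v [measurable]: "v \<in> borel_measurable M"
    and sym: "\<And>x y. K x y = K y x"
    and nonneg: "\<And>x y. 0 \<le> K x y"
    and int: "integrable (M \<Otimes>\<^sub>M M) (\<lambda>(x, y). K x y * (v x)\<^sup>2)"
  shows "0 \<le> (\<integral>x. (\<integral>y. K x y * (v x - v y) \<partial>M) * v x \<partial>M)"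
proof -
  interpret P: pair_sigma_finite M M ..
  have int': "integrable (M \<Otimes>\<^sub>M M) (\<lambda>(x, y). K x y * (v y)\<^sup>2)"
  proof -
    have "(\<lambda>(x, y). K x y * (v y)\<^sup>2) = (\<lambda>(x, y). case (y, x) of (x, y) \<Rightarrow> K x y * (v x)\<^sup>2)"
      using sym by (auto simp: fun_eq_iff)
    then show ?thesis
      using P.integrable_product_swap[OF int] by simp
  qed
  define g where "g = (\<lambda>(x, y). K x y * (v x - v y) * v x)"
  have g_meas [measurable]: "g \<in> borel_measurable (M \<Otimes>\<^sub>M M)"
    unfolding g_def by measurable
  have g_int: "integrable (M \<Otimes>\<^sub>M M) g"
  proof (rule Bochner_Integration.integrable_bound)
    show "integrable (M \<Otimes>\<^sub>M M) (\<lambda>z. 2 * (case z of (x, y) \<Rightarrow> K x y * (v x)\<^sup>2)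
        + (case z of (x, y) \<Rightarrow> K x y * (v y)\<^sup>2))"
      using int int' by (intro Bochner_Integration.integrable_add integrable_mult_right) 
    have "\<bar>K x y * (v x - v y) * v x\<bar> \<le> \<bar>2 * (K x y * (v x)\<^sup>2) + K x y * (v y)\<^sup>2\<bar>" for x y
    proof -
      have "\<bar>(v x - v y) * v x\<bar> \<le> 2 * (v x)\<^sup>2 + (v y)\<^sup>2"
      proof -
        have "(v x - v y) * v x = (v x)\<^sup>2 - v x * v y"
          by (simp add: power2_eq_square algebra_simps)
        moreover have "\<bar>2 * (v x * v y)\<bar> \<le> (v x)\<^sup>2 + (v y)\<^sup>2"
          using zero_le_power2[of "v x - v y"] zero_le_power2[of "v x + v y"]
          by (simp add: abs_le_iff power2_diff power2_sum)
        ultimately show ?thesis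
          using zero_le_power2[of "v x"] zero_le_power2[of "v y"] by linarith
      qed
      then have "K x y * \<bar>(v x - v y) * v x\<bar> \<le> K x y * (2 * (v x)\<^sup>2 + (v y)\<^sup>2)"
        using nonneg by (rule mult_left_mono)
      also have "\<dots> = \<bar>2 * (K x y * (v x)\<^sup>2) + K x y * (v y)\<^sup>2\<bar>"
        using nonneg[of x y] by (simp add: distrib_left)
      finally show ?thesis
        using nonneg[of x y] by (simp add: abs_mult mult.assoc)
    qed
    then show "AE z in M \<Otimes>\<^sub>M M. norm (g z) \<le> norm (2 * (case z of (x, y) \<Rightarrow> K x y * (v x)\<^sup>2)
        + (case z of (x, y) \<Rightarrow> K x y * (v y)\<^sup>2))"
      by (auto simp: g_def split: prod.split)
  qed measurable
  have swap_int: "integrable (M \<Otimes>\<^sub>M M) (\<lambda>(x, y). g (y, x))"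
    using P.integrable_product_swap[OF g_int] .
  have swap: "(\<integral>(x, y). g (y, x) \<partial>(M \<Otimes>\<^sub>M M)) = integral\<^sup>L (M \<Otimes>\<^sub>M M) g"
    using P.integral_product_swap[OF g_meas] .
  have "2 * integral\<^sup>L (M \<Otimes>\<^sub>M M) g
      = integral\<^sup>L (M \<Otimes>\<^sub>M M) (\<lambda>z. g z + (case z of (x, y) \<Rightarrow> g (y, x)))"
    using Bochner_Integration.integral_add[OF g_int swap_int] swap by simp
  also have "\<dots> = (\<integral>(x, y). K x y * (v x - v y)\<^sup>2 \<partial>(M \<Otimes>\<^sub>M M))"
  proof (rule Bochner_Integration.integral_cong)
    show "g z + (case z of (x, y) \<Rightarrow> g (y, x)) = (case z of (x, y) \<Rightarrow> K x y * (v x - v y)\<^sup>2)" for z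
      using sym[of "fst z" "snd z"]
      by (simp add: g_def case_prod_beta power2_eq_square algebra_simps)
  qed simp
  also have "\<dots> \<ge> 0"
    using nonneg by (intro Bochner_Integration.integral_nonneg) auto
  finally have "0 \<le> integral\<^sup>L (M \<Otimes>\<^sub>M M) g"
    by simp
  also have "\<dots> = (\<integral>x. (\<integral>y. g (x, y) \<partial>M) \<partial>M)"
    using P.integral_fst'[OF g_int] by simp
  finally show ?thesis
    by (simp add: g_def)
qed

section \<open>Reflections and translations of the Lebesgue measure\<close>

text \<open>
  Only \<open>c = 1\<close> and \<open>c = - 1\<close> occur: the translations move the cell by lattice vectors, and
  \<open>y \<mapsto> x - y\<close> turns statements on the kernel \<open>J\<close> into statements on \<open>J (x - y)\<close> for fixed \<open>x\<close>.
\<close>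

lemma lebesgue_affine_isometry:
  fixes t :: "'a::euclidean_space"
  assumes "\<bar>c\<bar> = 1"
  shows "(\<lambda>x. t + c *\<^sub>R x) \<in> lebesgue \<rightarrow>\<^sub>M lebesgue"
    and "distr lebesgue lebesgue (\<lambda>x. t + c *\<^sub>R x) = lebesgue"
proof -
  have T: "(\<lambda>x. t + (\<Sum>j\<in>Basis. (c * (x \<bullet> j)) *\<^sub>R j)) = (\<lambda>x. t + c *\<^sub>R x)"
    unfolding scaleR_scaleR[symmetric] scaleR_sum_right[symmetric] euclidean_representation ..
  have "c \<noteq> 0"
    using assms by auto
  then show "(\<lambda>x. t + c *\<^sub>R x) \<in> lebesgue \<rightarrow>\<^sub>M lebesgue"
    using lebesgue_affine_measurable[of "\<lambda>_. c" t] by (simp add: T)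
  have "lebesgue = density (distr lebesgue lebesgue (\<lambda>x. t + c *\<^sub>R x)) (\<lambda>_. 1)"
    using lebesgue_affine_euclidean[of "\<lambda>_. c" t] \<open>c \<noteq> 0\<close> assms by (simp add: T)
  then show "distr lebesgue lebesgue (\<lambda>x. t + c *\<^sub>R x) = lebesgue"
    by (simp add: density_1)
qed

lemma
  fixes t :: "'a::euclidean_space" and f :: "'a \<Rightarrow> real"
  assumes "\<bar>c\<bar> = 1"
  shows integrable_lebesgue_affine_isometry:
      "integrable lebesgue f \<Longrightarrow> integrable lebesgue (\<lambda>x. f (t + c *\<^sub>R x))"
    and integral_lebesgue_affine_isometry:
      "f \<in> borel_measurable lebesgue \<Longrightarrow>
        (\<integral>x. f (t + c *\<^sub>R x) \<partial>lebesgue) = (\<integral>x. f x \<partial>lebesgue)"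
    and AE_lebesgue_affine_isometry:
      "(AE x in lebesgue. P x) \<Longrightarrow> (AE x in lebesgue. P (t + c *\<^sub>R x))"
  using integrable_distr[OF lebesgue_affine_isometry(1)[OF assms, of t], of f]
    integral_distr[OF lebesgue_affine_isometry(1)[OF assms, of t], of f]
    AE_distrD[OF lebesgue_affine_isometry(1)[OF assms, of t], of P]
  unfolding lebesgue_affine_isometry(2)[OF assms] by auto

section \<open>Periodic functions are locally integrable\<close>

lemma cell_periodic_lattice_translate:
  assumes "cell_periodic a b u"
  shows "u (x + (\<chi> i. of_int (m i) * (b $ i - a $ i))) = u x"
proof -
  have coord: "u (x + of_int k *\<^sub>R axis i (b $ i - a $ i)) = u x" for x k i
  proof (induction k rule: int_induct[where k = 0])
    case (step1 k)
    then show ?case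
      using assms[unfolded cell_periodic_def, rule_format,
          of "x + of_int k *\<^sub>R axis i (b $ i - a $ i)" i]
      by (simp add: algebra_simps)
  next
    case (step2 k)
    then show ?case
      using assms[unfolded cell_periodic_def, rule_format,
          of "x + of_int (k - 1) *\<^sub>R axis i (b $ i - a $ i)" i]
      by (simp add: algebra_simps)
  qed simp
  have "u (x + (\<Sum>i\<in>I. of_int (m i) *\<^sub>R axis i (b $ i - a $ i))) = u x" if "finite I" for I
    using that
  proof (induction I)
    case (insert i I)
    then show ?case
      using coord[of "x + (\<Sum>i\<in>I. of_int (m i) *\<^sub>R axis i (b $ i - a $ i))" "m i" i]
      by (simp add: add_ac)
  qed simp
  moreover have "(\<Sum>i\<in>UNIV. of_int (m i) *\<^sub>R axis i (b $ i - a $ i))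
      = (\<chi> i. of_int (m i) * (b $ i - a $ i))"
    by (simp add: vec_eq_iff axis_def if_distrib cong: if_cong)
  ultimately show ?thesis
    by (metis finite)
qed

text \<open>Every point is moved into the cell by a vector of the period lattice, given by floors.\<close>

lemma lattice_reduction:
  fixes a b x :: "real^'d"
  assumes "\<And>i. a $ i < b $ i"
  shows "x - (\<chi> i. of_int \<lfloor>(x $ i - a $ i) / (b $ i - a $ i)\<rfloor> * (b $ i - a $ i)) \<in> cbox a b"
proof -
  have "a $ i \<le> x $ i - of_int \<lfloor>(x $ i - a $ i) / (b $ i - a $ i)\<rfloor> * (b $ i - a $ i)
      \<and> x $ i - of_int \<lfloor>(x $ i - a $ i) / (b $ i - a $ i)\<rfloor> * (b $ i - a $ i) \<le> b $ i" for i
  proof -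
    define p where "p = b $ i - a $ i"
    define q where "q = (x $ i - a $ i) / p"
    have "0 < p" "x $ i = a $ i + q * p"
      using assms[of i] by (auto simp: p_def q_def)
    moreover have "of_int \<lfloor>q\<rfloor> * p \<le> q * p" "q * p \<le> (of_int \<lfloor>q\<rfloor> + 1) * p"
      using \<open>0 < p\<close> by (intro mult_right_mono; linarith)+
    ultimately show ?thesis
      unfolding q_def[symmetric] p_def[symmetric] by (simp add: algebra_simps p_def)
  qed
  then show ?thesis
    by (simp add: mem_box_cart)
qed

text \<open>
  A box meets only finitely many lattice translates of the cell, because the integer
  coordinates of the translates needed lie between those of its two extreme corners; on each of
  them the function is a translate of its restriction to the cell.
\<close>

lemma cell_periodic_set_integrable_cbox:
  fixes a b c d :: "real^'d" and u :: "real^'d \<Rightarrow> real"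
  assumes cell: "\<And>i. a $ i < b $ i" and per: "cell_periodic a b u"
    and int: "set_integrable lebesgue (cbox a b) u"
  shows "set_integrable lebesgue (cbox c d) u"
proof -
  define q where "q x i = \<lfloor>(x $ i - a $ i) / (b $ i - a $ i)\<rfloor>" for x :: "real^'d" and i
  define S where "S = (\<Pi>\<^sub>E i\<in>UNIV. {q c i..q d i})"
  define v where "v m = (\<chi> i. of_int (m i) * (b $ i - a $ i))" for m :: "'d \<Rightarrow> int"
  have "finite S"
    unfolding S_def by (intro finite_PiE) auto
  have cover: "cbox c d \<subseteq> (\<Union>m\<in>S. (+) (v m) ` cbox a b)"
  proof
    fix x assume x: "x \<in> cbox c d"
    have "q c i \<le> q x i \<and> q x i \<le> q d i" for i
      using x cell[of i] unfolding q_def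
      by (auto simp: mem_box_cart intro!: floor_mono divide_right_mono)
    then have "q x \<in> S"
      by (auto simp: S_def PiE_UNIV_domain)
    moreover have "x - v (q x) \<in> cbox a b"
      using lattice_reduction[OF cell, of x] by (simp add: v_def q_def)
    ultimately show "x \<in> (\<Union>m\<in>S. (+) (v m) ` cbox a b)"
      by (intro UN_I[of "q x"] image_eqI[of _ _ "x - v (q x)"]) auto
  qed
  have "set_integrable lebesgue ((+) (v m) ` cbox a b) u" for m
  proof -
    have "integrable lebesgue (\<lambda>x. indicator (cbox a b) (- v m + 1 *\<^sub>R x) *\<^sub>R u (- v m + 1 *\<^sub>R x))"
      using int unfolding set_integrable_def
      by (intro integrable_lebesgue_affine_isometry[where f = "\<lambda>x. indicator (cbox a b) x *\<^sub>R u x"]) auto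
    moreover have "u (- v m + x) = u x" for x
      using cell_periodic_lattice_translate[OF per, of "- v m + x" m] by (simp add: v_def)
    moreover have "indicator (cbox a b) (- v m + x) = (indicator ((+) (v m) ` cbox a b) x :: real)" for x
      by (auto simp: indicator_def image_iff)
    ultimately show ?thesis
      by (simp add: set_integrable_def)
  qed
  then have "set_integrable lebesgue (\<Union>m\<in>S. (+) (v m) ` cbox a b) u"
    using \<open>finite S\<close> by (intro set_integrable_UN) (auto intro!: lebesgue_sets_translation)
  then show ?thesis
    by (rule set_integrable_subset[OF _ _ cover]) simp
qed

lemma interaction_kernel_nonneg:
  assumes "\<And>i. a $ i < b $ i" and "interaction_kernel a b J"
  shows "0 \<le> J x"
proof -
  have per: "cell_periodic a b J" and cell_nonneg: "\<And>z. z \<in> cbox a b \<Longrightarrow> 0 \<le> J z"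
    using assms(2) unfolding interaction_kernel_def by blast+
  define m where "m i = \<lfloor>(x $ i - a $ i) / (b $ i - a $ i)\<rfloor>" for i
  have "0 \<le> J (x - (\<chi> i. of_int (m i) * (b $ i - a $ i)))"
    using lattice_reduction[OF assms(1), of x] by (intro cell_nonneg) (simp add: m_def)
  then show ?thesis
    using cell_periodic_lattice_translate[OF per, of "x - (\<chi> i. of_int (m i) * (b $ i - a $ i))" m]
    by simp
qed

section \<open>The nonlocal operator is positive semidefinite\<close>

text \<open>
  The function \<open>(x, y) \<mapsto> k (x - y)\<close> has to be measurable for the product \<open>\<sigma>\<close>-algebra, which is
  immediate for Borel measurable \<open>k\<close> only. Averaging an arbitrary Borel representative over the
  reflection makes it even at every point, not just almost everywhere.
\<close>

lemma even_kernel_borel_representative: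
  fixes k :: "'a::euclidean_space \<Rightarrow> real"
  assumes int: "integrable lebesgue k" and nonneg: "\<And>z. 0 \<le> k z" and even: "\<And>z. k (- z) = k z"
  obtains G where "G \<in> borel_measurable borel" "integrable lborel G"
    "\<And>z. 0 \<le> G z" "\<And>z. G (- z) = G z" "AE z in lebesgue. k z = G z"
proof -
  obtain g where g [measurable]: "g \<in> borel_measurable lborel" and kg: "AE z in lborel. k z = g z"
    using completion_ex_borel_measurable_real[OF borel_measurable_integrable[OF int]] by blast
  define G where "G z = (max 0 (g z) + max 0 (g (- z))) / 2" for z
  have G_meas [measurable]: "G \<in> borel_measurable borel"
    unfolding G_def using g by measurable
  have kg': "AE z in lebesgue. k z = g z"
    using kg by (rule AE_completion)
  have "AE z in lebesgue. k (0 + (-1) *\<^sub>R z) = g (0 + (-1) *\<^sub>R z)"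
    using kg' by (intro AE_lebesgue_affine_isometry) auto
  with kg' have kG: "AE z in lebesgue. k z = G z"
  proof eventually_elim
    case (elim z)
    then show ?case
      using nonneg[of z] even[of z] by (simp add: G_def)
  qed
  have "integrable lebesgue G"
    using int G_meas kG
    by (intro integrable_cong_AE_imp[OF int]) (auto intro: measurable_completion)
  then have "integrable lborel G"
    by (simp add: integrable_completion)
  then show ?thesis
    using kG by (intro that[of G]) (auto simp: G_def)
qed

text \<open>
  The integrability hypothesis of the symmetric form holds because the integral of \<open>G (x - y)\<close>
  over all \<open>y\<close> does not depend on \<open>x\<close>, so that the double integral of \<open>G (x - y) * (v x)\<^sup>2\<close> is the
  product of the two integrals.
\<close>

lemma convolution_kernel_form_nonneg:
  fixes G v :: "'a::euclidean_space \<Rightarrow> real"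
  assumes G [measurable]: "G \<in> borel_measurable borel" and G_int: "integrable lborel G"
    and nonneg: "\<And>z. 0 \<le> G z" and even: "\<And>z. G (- z) = G z"
    and v [measurable]: "v \<in> borel_measurable borel" and v_int: "integrable lborel (\<lambda>x. (v x)\<^sup>2)"
    and A [measurable]: "A \<in> sets borel"
  shows "0 \<le> (\<integral>x. (\<integral>y. indicator A x * indicator A y * G (x - y) * (v x - v y) \<partial>lborel) * v x \<partial>lborel)"
proof (rule lborel.symmetric_kernel_form_nonneg)
  have G_trans: "integrable lborel (\<lambda>y. G (x - y))"
    and G_mass: "(\<integral>y. G (x - y) \<partial>lborel) = (\<integral>z. G z \<partial>lborel)" for x
  proof -
    have "integrable lebesgue (\<lambda>y. G (x + (-1) *\<^sub>R y))"
      using G_int by (intro integrable_lebesgue_affine_isometry) (simp_all add: integrable_completion)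
    then show "integrable lborel (\<lambda>y. G (x - y))"
      by (simp add: integrable_completion)
    have "(\<integral>y. G (x + (-1) *\<^sub>R y) \<partial>lebesgue) = (\<integral>z. G z \<partial>lebesgue)"
      by (intro integral_lebesgue_affine_isometry) (auto intro: measurable_completion)
    then show "(\<integral>y. G (x - y) \<partial>lborel) = (\<integral>z. G z \<partial>lborel)"
      by (simp add: integral_completion)
  qed
  have "integrable (lborel \<Otimes>\<^sub>M lborel) (\<lambda>(x, y). G (x - y) * (v x)\<^sup>2)"
  proof (rule lborel_pair.Fubini_integrable)
    show "integrable lborel (\<lambda>x. \<integral>y. norm (case (x, y) of (x, y) \<Rightarrow> G (x - y) * (v x)\<^sup>2) \<partial>lborel)"
      using v_int nonneg G_mass by (simp add: abs_mult)
    show "AE x in lborel. integrable lborel (\<lambda>y. case (x, y) of (x, y) \<Rightarrow> G (x - y) * (v x)\<^sup>2)"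
      using G_trans by simp
  qed measurable
  then show "integrable (lborel \<Otimes>\<^sub>M lborel)
      (\<lambda>(x, y). indicator A x * indicator A y * G (x - y) * (v x)\<^sup>2)"
    by (rule Bochner_Integration.integrable_bound)
      (measurable, auto simp: nonneg indicator_def)
  show "indicator A x * indicator A y * G (x - y) = indicator A y * indicator A x * G (y - x)" for x y
    using even[of "x - y"] by simp
qed (use nonneg in auto)

text \<open>
  For \<open>x\<close> and \<open>y\<close> in the cell, \<open>x - y\<close> ranges over the box \<open>?D\<close> of twice the side lengths, so
  periodicity is used to integrate \<open>J\<close> there. The form is then rewritten with Borel
  representatives: for each fixed \<open>x\<close> the exceptional set of \<open>J (x - y)\<close> is a reflected and
  translated null set in \<open>y\<close>.
\<close>

lemma nonlocal_op_nonneg: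
  fixes a b :: "real^'d" and J u :: "real^'d \<Rightarrow> real"
  assumes cell: "\<And>i. a $ i < b $ i" and kernel: "interaction_kernel a b J"
    and u: "L2_fun (cbox a b) u"
  shows "0 \<le> L2_inner (cbox a b) (nonlocal_op (cbox a b) J u) u"
proof -
  let ?\<Omega> = "cbox a b"
  let ?D = "cbox (a - b) (b - a)"
  have J_nonneg: "0 \<le> J z" for z
    using interaction_kernel_nonneg[OF cell kernel] .
  have J_int: "integrable (lebesgue_on ?\<Omega>) J" and J_per: "cell_periodic a b J"
    and J_even': "\<And>z. J z = J (- z)"
    using kernel unfolding interaction_kernel_def by blast+
  note J_even = J_even'[symmetric]
  have "set_integrable lebesgue ?\<Omega> J"
    using J_int by (simp add: integrable_restrict_space set_integrable_def)
  then have "set_integrable lebesgue ?D J"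
    by (rule cell_periodic_set_integrable_cbox[OF cell J_per])
  moreover have "indicator ?D (- z) = (indicator ?D z :: real)" for z
  proof -
    have "(a - b) $ i \<le> (- z) $ i \<and> (- z) $ i \<le> (b - a) $ i
        \<longleftrightarrow> (a - b) $ i \<le> z $ i \<and> z $ i \<le> (b - a) $ i" for i
      by auto
    then have "- z \<in> ?D \<longleftrightarrow> z \<in> ?D"
      by (simp only: mem_box_cart)
    then show ?thesis
      by (simp add: indicator_def)
  qed
  ultimately obtain G where G [measurable]: "G \<in> borel_measurable borel"
    and G_int: "integrable lborel G" and G_nonneg: "\<And>z. 0 \<le> G z" and G_even: "\<And>z. G (- z) = G z"
    and JG: "AE z in lebesgue. indicator ?D z * J z = G z"
    using even_kernel_borel_representative[of "\<lambda>z. indicator ?D z * J z"] J_nonneg J_even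
    by (simp add: set_integrable_def) blast

  have "(\<lambda>x. indicator ?\<Omega> x * u x) \<in> borel_measurable lebesgue"
    using u by (simp add: L2_fun_def borel_measurable_restrict_space_iff)
  then obtain v0 where v0 [measurable]: "v0 \<in> borel_measurable lborel"
    and uv0: "AE x in lborel. indicator ?\<Omega> x * u x = v0 x"
    using completion_ex_borel_measurable_real by blast
  define v where "v x = indicator ?\<Omega> x * v0 x" for x
  have v [measurable]: "v \<in> borel_measurable borel"
    unfolding v_def using v0 by measurable
  have uv: "AE x in lebesgue. indicator ?\<Omega> x * u x = v x"
    using AE_completion[OF uv0] by eventually_elim (auto simp: v_def indicator_def split: if_splits)
  have "integrable lebesgue (\<lambda>x. indicator ?\<Omega> x * (u x)\<^sup>2)"
    using u by (simp add: L2_fun_def integrable_restrict_space)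
  moreover have "AE x in lebesgue. indicator ?\<Omega> x * (u x)\<^sup>2 = (v x)\<^sup>2"
    using uv by eventually_elim (auto simp: indicator_def v_def split: if_splits)
  ultimately have "integrable lebesgue (\<lambda>x. (v x)\<^sup>2)"
    by (intro integrable_cong_AE_imp[where f = "\<lambda>x. (v x)\<^sup>2"])
      (auto intro: measurable_completion)
  then have v_int: "integrable lborel (\<lambda>x. (v x)\<^sup>2)"
    by (simp add: integrable_completion)

  define K where "K x y = indicator ?\<Omega> x * indicator ?\<Omega> y * G (x - y)" for x y
  have K [measurable]: "case_prod K \<in> borel_measurable (borel \<Otimes>\<^sub>M borel)"
    unfolding K_def by measurable
  have inner: "nonlocal_op ?\<Omega> J u x = (\<integral>y. K x y * (v x - v y) \<partial>lborel)"
    if x: "x \<in> ?\<Omega>" and ux: "u x = v x" for x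
  proof -
    have "AE y in lebesgue. indicator ?D (x + (-1) *\<^sub>R y) * J (x + (-1) *\<^sub>R y) = G (x + (-1) *\<^sub>R y)"
      using JG by (intro AE_lebesgue_affine_isometry) auto
    with uv have eq: "AE y in lebesgue. K x y * (v x - v y)
        = indicator ?\<Omega> y * (J (x - y) * (u x - u y))"
    proof eventually_elim
      case (elim y)
      show ?case
      proof (cases "y \<in> ?\<Omega>")
        case True
        then have "x - y \<in> ?D"
          using x by (auto simp: mem_box_cart intro!: diff_mono)
        then show ?thesis
          using elim True x ux by (simp add: K_def)
      qed (simp add: K_def)
    qed
    have meas: "(\<lambda>y. K x y * (v x - v y)) \<in> borel_measurable lborel"
      by measurable
    have "nonlocal_op ?\<Omega> J u x = (\<integral>y. indicator ?\<Omega> y * (J (x - y) * (u x - u y)) \<partial>lebesgue)"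
      by (simp add: nonlocal_op_def integral_restrict_space)
    also have "\<dots> = (\<integral>y. K x y * (v x - v y) \<partial>lebesgue)"
      using eq measurable_completion[OF meas]
      by (intro integral_cong_AE borel_measurable_AE[OF _ eq]) auto
    finally show ?thesis
      using meas by (simp add: integral_completion)
  qed

  let ?h = "\<lambda>x. (\<integral>y. K x y * (v x - v y) \<partial>lborel) * v x"
  have meas: "?h \<in> borel_measurable lborel"
    by measurable
  have eq: "AE x in lebesgue. ?h x = indicator ?\<Omega> x * (nonlocal_op ?\<Omega> J u x * u x)"
    using uv
  proof eventually_elim
    case (elim x)
    show ?case
    proof (cases "x \<in> ?\<Omega>")
      case True
      then show ?thesis
        using elim inner[of x] by simp
    qed (simp add: v_def)
  qed
  have "L2_inner ?\<Omega> (nonlocal_op ?\<Omega> J u) u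
      = (\<integral>x. indicator ?\<Omega> x * (nonlocal_op ?\<Omega> J u x * u x) \<partial>lebesgue)"
    by (simp add: L2_inner_def integral_restrict_space)
  also have "\<dots> = (\<integral>x. ?h x \<partial>lebesgue)"
    using eq measurable_completion[OF meas]
    by (intro integral_cong_AE borel_measurable_AE[OF _ eq]) auto
  also have "\<dots> = (\<integral>x. ?h x \<partial>lborel)"
    using meas by (simp add: integral_completion)
  also have "\<dots> \<ge> 0"
    unfolding K_def
    using convolution_kernel_form_nonneg[OF G G_int G_nonneg G_even v v_int, of ?\<Omega>] by simp
  finally show ?thesis .
qed

section \<open>Decay of the auxiliary variable\<close>

text \<open>
  The step is linearly implicit, with \<open>(1 - d) * r' = r\<close> and \<open>1 - d \<ge> 1\<close>; the size of the time step
  enters \<open>d\<close> as a factor and does not change its sign, hence unconditional stability.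
\<close>

lemma implicit_step_pos:
  fixes r r' d :: real
  assumes "0 < r" and "r' - r = r' * d" and "d \<le> 0"
  shows "0 < r'"
proof -
  have "r' * (1 - d) = r"
    using assms(2) by (simp add: algebra_simps)
  then show ?thesis
    using assms(1,3) by (smt (verit) zero_less_mult_pos2)
qed

theorem theorem3p3:
  fixes a b :: "real^'d" and \<Omega> :: "(real^'d) set"
    and J :: "real^'d \<Rightarrow> real" and F f :: "real \<Rightarrow> real"
    and k N :: nat and \<tau> M \<epsilon> :: real
    and extrap :: "nat \<Rightarrow> (real^'d \<Rightarrow> real) list \<Rightarrow> real^'d \<Rightarrow> real"
    and \<phi> \<phi>s \<mu> \<mu>bar :: "nat \<Rightarrow> real^'d \<Rightarrow> real"
    and R \<xi> :: "nat \<Rightarrow> real"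
  assumes dim: "CARD('d) \<in> {1, 2, 3}"
    and cell: "\<And>i. a $ i < b $ i" "\<Omega> = cbox a b"
    and kernel: "interaction_kernel a b J"
    and F_C1: "\<And>s. (F has_real_derivative f s) (at s)" "continuous_on UNIV f"
    and k: "k \<in> {2, 3, 4}" "k \<le> N"
    and \<tau>: "0 < \<tau>" and M: "0 < M" and \<epsilon>: "0 < \<epsilon>" "\<epsilon> \<le> 1"
    and \<mu>bar: "\<And>n. n \<in> {k-1..N-1} \<Longrightarrow> \<mu>bar (n+1) = chem_potential \<Omega> J \<epsilon> f (\<phi>s (n+1))"
    and periodic:
      "\<And>n. n \<le> N \<Longrightarrow> cell_periodic a b (\<phi> n)"
      "\<And>n. n \<in> {k-1..N-1} \<Longrightarrow> cell_periodic a b (\<phi>s (n+1))"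
      "\<And>n. n \<in> {k-1..N-1} \<Longrightarrow> cell_periodic a b (\<mu> (n+1))"
    and square_integrable:
      "\<And>n. n \<le> N \<Longrightarrow> L2_fun \<Omega> (\<phi> n)"
      "\<And>n. n \<in> {k-1..N-1} \<Longrightarrow> L2_fun \<Omega> (\<phi>s (n+1))"
      "\<And>n. n \<in> {k-1..N-1} \<Longrightarrow> L2_fun \<Omega> (\<lambda>x. f (\<phi>s (n+1) x))"
      "\<And>n. n \<in> {k-1..N-1} \<Longrightarrow> L2_fun \<Omega> (\<mu> (n+1))"
      "\<And>n. n \<in> {k-1..N-1} \<Longrightarrow> L2_fun \<Omega> (\<mu>bar (n+1))"
    and finite_energy:
      "integrable (lebesgue_on \<Omega>) (\<lambda>x. F (\<phi> 0 x))"
      "\<And>n. n \<in> {k-1..N-1} \<Longrightarrow> integrable (lebesgue_on \<Omega>) (\<lambda>x. F (\<phi>s (n+1) x))"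
    and R_start: "R 0 = exp (free_energy \<Omega> J \<epsilon> F (\<phi> 0))" "\<And>m. m \<in> {1..k-1} \<Longrightarrow> 0 < R m"
    and scheme: "esi_sav_scheme k N \<tau> M \<epsilon> \<Omega> J F f extrap \<phi> \<phi>s \<mu> R \<xi>"
  shows "\<forall>n\<in>{k-1..N-1}.
      R (n+1) - R n
        = R (n+1) * \<tau> * L2_inner \<Omega> (\<lambda>x. - M * nonlocal_op \<Omega> J (\<mu>bar (n+1)) x) (\<mu>bar (n+1)) \<and>
      R (n+1) * \<tau> * L2_inner \<Omega> (\<lambda>x. - M * nonlocal_op \<Omega> J (\<mu>bar (n+1)) x) (\<mu>bar (n+1)) \<le> 0 \<and>
      0 < R n \<and> 0 < R (n+1) \<and> ln (R (n+1)) - ln (R n) \<le> 0"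
proof -
  define d where
    "d n = \<tau> * L2_inner \<Omega> (\<lambda>x. - M * nonlocal_op \<Omega> J (\<mu>bar (n+1)) x) (\<mu>bar (n+1))" for n
  have d: "d n \<le> 0" and decay: "R (n+1) - R n = R (n+1) * d n" if n: "n \<in> {k-1..N-1}" for n
  proof -
    have "L2_inner \<Omega> (\<lambda>x. - M * nonlocal_op \<Omega> J (\<mu>bar (n+1)) x) (\<mu>bar (n+1))
        = - M * L2_inner \<Omega> (nonlocal_op \<Omega> J (\<mu>bar (n+1))) (\<mu>bar (n+1))"
      by (simp add: L2_inner_def mult.assoc)
    moreover have "0 \<le> L2_inner \<Omega> (nonlocal_op \<Omega> J (\<mu>bar (n+1))) (\<mu>bar (n+1))"
      using nonlocal_op_nonneg[OF cell(1) kernel] square_integrable(5)[OF n] cell(2) by simp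
    ultimately show "d n \<le> 0"
      using \<tau> M by (simp add: d_def mult_nonneg_nonneg)
    have "(R (n+1) - R n) / \<tau> =
        R (n+1) * L2_inner \<Omega> (\<lambda>x. - M * nonlocal_op \<Omega> J (\<mu>bar (n+1)) x) (\<mu>bar (n+1))"
      using scheme n unfolding esi_sav_scheme_def \<mu>bar[OF n] by blast
    then show "R (n+1) - R n = R (n+1) * d n"
      using \<tau> by (simp add: d_def field_simps)
  qed
  have start: "0 < R (k-1)"
    using k by (intro R_start(2)) auto
  have pos: "0 < R n" if "k - 1 \<le> n" "n \<le> N" for n
    using that
  proof (induction n rule: dec_induct)
    case (step m)
    then have m: "m \<in> {k-1..N-1}"
      by auto
    show ?case
      using implicit_step_pos[OF _ decay[OF m] d[OF m]] step by simp
  qed (use start in simp)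
  show ?thesis
  proof (intro ballI)
    fix n assume n: "n \<in> {k-1..N-1}"
    then have R: "0 < R n" "0 < R (n+1)"
      using k pos[of n] pos[of "n+1"] by auto
    have le: "R (n+1) * d n \<le> 0"
      using R d[OF n] by (simp add: mult_nonneg_nonpos)
    then have "ln (R (n+1)) \<le> ln (R n)"
      using R decay[OF n] by simp
    then show "R (n+1) - R n
        = R (n+1) * \<tau> * L2_inner \<Omega> (\<lambda>x. - M * nonlocal_op \<Omega> J (\<mu>bar (n+1)) x) (\<mu>bar (n+1)) \<and>
      R (n+1) * \<tau> * L2_inner \<Omega> (\<lambda>x. - M * nonlocal_op \<Omega> J (\<mu>bar (n+1)) x) (\<mu>bar (n+1)) \<le> 0 \<and>
      0 < R n \<and> 0 < R (n+1) \<and> ln (R (n+1)) - ln (R n) \<le> 0"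
      using R le decay[OF n] by (simp add: d_def mult.assoc)
  qed
qed

end
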